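(* Let $h(\pi,\pi_0)$ be a convex differentiable positive homogeneous function. Assuming that the normalized separation problem $$d_h^*(\hat y,\hat\eta)=\max\{\pi^\top(b-B\hat y)+\pi_0(f^\top\hat y-\hat\eta):\ (\pi,\pi_0)\in\Pi,\ h(\pi,\pi_0)\le1\}$$ admits a bounded optimal solution $(\pi^*,\pi_0^* )$, this problem is equivalent to the following linear program: $$\begin{aligned} d_h^*(\hat y,\hat\eta)=\min\quad & z\\ \text{s.t.}\quad & Ax\ge b-B\hat y-z\,\nabla_{\pi}h(\pi^*,\pi_0^* ),\\ & c^\top x\le\hat\eta-f^\top\hat y+z\,\nabla_{\pi_0}h(\pi^*,\pi_0^* ),\\ & x\ge0.\end{aligned}$$
   Context: Data: $f\in\mathbb{R}^n$, $c\in\mathbb{R}^{n'}$, $b\in\mathbb{R}^m$, $A\in\mathbb{R}^{m\times n'}$, $B\in\mathbb{R}^{m\times n}$, coming from a bounded mixed-integer linear program $\min\{c^\top x+f^\top y: Ax+By\ge b,\ x\ge0,\ y\in Y\}$ with $Y\subset\mathbb{Z}^n$. The cone of dual solutions is $\Pi=\{(\pi,\pi_0)\in\mathbb{R}^m\times\mathbb{R}:\pi^\top A\le\pi_0c^\top,\ \pi\ge0,\ \pi_0\ge0\}$, and $(\hat y,\hat\eta)\in\mathbb{R}^n\times\mathbb{R}$ is the incumbent point. Positive homogeneous means $h(\alpha\pi,\alpha\pi_0)=\alpha h(\pi,\pi_0)$ for any $\alpha\ge0$. $\nabla_\pi h$ and $\nabla_{\pi_0}h$ denote the parts of the gradient of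 $h$ with respect to $\pi$ and $\pi_0$. The variables of the linear program are $x\in\mathbb{R}^{n'}$ and $z\in\mathbb{R}$.
   Formalization: Adds the hypothesis that if d_h^* = 0 then h(π*,π0* ) > 0 (otherwise false, e.g. h = 0 makes the linear program unbounded); differentiability of h is required only away from the origin. *)

theory Defs
  imports "HOL-Analysis.Analysis"
begin

text \<open>
  Inequalities between vectors of type \<open>real ^ 'k\<close> are the library's componentwise order.
  A dual pair \<open>(\<pi>, \<pi>\<^sub>0)\<close> is an element of \<open>(real ^ 'm) \<times> real\<close>.
\<close>

definition dual_cone :: "real ^ 'np ^ 'm \<Rightarrow> real ^ 'np \<Rightarrow> ((real ^ 'm) \<times> real) set" where
  "dual_cone A c = {(\<pi>, \<pi>\<^sub>0). \<pi> v* A \<le> \<pi>\<^sub>0 *\<^sub>R c \<and> 0 \<le> \<pi> \<and> 0 \<le> \<pi>\<^sub>0}"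

definition pos_homogeneous :: "('a::real_vector \<Rightarrow> real) \<Rightarrow> bool" where
  "pos_homogeneous h \<longleftrightarrow> (\<forall>\<alpha> p. 0 \<le> \<alpha> \<longrightarrow> h (\<alpha> *\<^sub>R p) = \<alpha> * h p)"

definition sep_objective ::
  "real ^ 'm \<Rightarrow> real ^ 'n ^ 'm \<Rightarrow> real ^ 'n \<Rightarrow> real ^ 'n \<Rightarrow> real \<Rightarrow> (real ^ 'm) \<times> real \<Rightarrow> real" where
  "sep_objective b B f yhat \<eta>hat =
     (\<lambda>(\<pi>, \<pi>\<^sub>0). \<pi> \<bullet> (b - B *v yhat) + \<pi>\<^sub>0 * (f \<bullet> yhat - \<eta>hat))"

definition sep_feasible ::
  "real ^ 'np ^ 'm \<Rightarrow> real ^ 'np \<Rightarrow> ((real ^ 'm) \<times> real \<Rightarrow> real) \<Rightarrow> ((real ^ 'm) \<times> real) set" where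
  "sep_feasible A c h = {p \<in> dual_cone A c. h p \<le> 1}"

text \<open>
  The value \<open>d\<^sub>h\<^sup>*\<close>. The supremum of reals is only meaningful
  when the objective is bounded above on the feasible set; it is used below only when the
  maximum is attained, in which case it is that maximum.
\<close>

definition sep_value ::
  "real ^ 'np ^ 'm \<Rightarrow> real ^ 'm \<Rightarrow> real ^ 'np \<Rightarrow> real ^ 'n ^ 'm \<Rightarrow> real ^ 'n \<Rightarrow>
   ((real ^ 'm) \<times> real \<Rightarrow> real) \<Rightarrow> real ^ 'n \<Rightarrow> real \<Rightarrow> real" where
  "sep_value A b c B f h yhat \<eta>hat =
     (SUP p \<in> sep_feasible A c h. sep_objective b B f yhat \<eta>hat p)"

text \<open>
  A positively homogeneous function that is differentiable at the origin is linear, so norm-like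
  functions are only differentiable on \<open>- {0}\<close>. At a point where \<open>h\<close> is not
  differentiable \<open>gradient h p\<close> is unspecified.
\<close>

definition gradient :: "('a::real_inner \<Rightarrow> real) \<Rightarrow> 'a \<Rightarrow> 'a" where
  "gradient h p = (THE D. GDERIV h p :> D)"

text \<open>
  On a product space the inner product is the sum of those of the factors, so the components
  of the gradient are the partial gradients.
\<close>

definition grad_pi :: "((real ^ 'm) \<times> real \<Rightarrow> real) \<Rightarrow> (real ^ 'm) \<times> real \<Rightarrow> real ^ 'm" where
  "grad_pi h p = fst (gradient h p)"

definition grad_pi0 :: "((real ^ 'm) \<times> real \<Rightarrow> real) \<Rightarrow> (real ^ 'm) \<times> real \<Rightarrow> real" where
  "grad_pi0 h p = snd (gradient h p)"

lemma gderiv_gradient: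
  fixes h :: "'a::euclidean_space \<Rightarrow> real"
  assumes "h differentiable (at p)"
  shows "GDERIV h p :> gradient h p"
proof -
  obtain h' where h': "(h has_derivative h') (at p)"
    using assms by (auto simp: differentiable_def)
  define D where "D = (\<Sum>i\<in>Basis. h' i *\<^sub>R i)"
  interpret h': bounded_linear h' using h' by (rule has_derivative_bounded_linear)
  have "h' v = v \<bullet> D" for v
  proof -
    have "h' v = h' (\<Sum>i\<in>Basis. (v \<bullet> i) *\<^sub>R i)" by (simp add: euclidean_representation)
    also have "\<dots> = v \<bullet> D" by (simp add: h'.sum h'.scaleR D_def inner_sum_right mult.commute)
    finally show ?thesis .
  qed
  then have "h' = (\<lambda>v. v \<bullet> D)" by (rule ext)
  with h' have D: "GDERIV h p :> D" by (simp add: gderiv_def)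
  have "E = D" if "GDERIV h p :> E" for E
  proof -
    have "(\<lambda>v. v \<bullet> E) = (\<lambda>v. v \<bullet> D)"
      using that D unfolding gderiv_def by (rule has_derivative_unique)
    then show ?thesis by (metis inner_commute vector_eq_ldot)
  qed
  with D show ?thesis unfolding gradient_def by (rule theI)
qed

text \<open>
  Feasible pairs \<open>(x, z)\<close> of the linear program with gradient parts \<open>g\<close> and \<open>g\<^sub>0\<close>;
  the variable \<open>z\<close> is free.
\<close>

definition lp_feasible ::
  "real ^ 'np ^ 'm \<Rightarrow> real ^ 'm \<Rightarrow> real ^ 'np \<Rightarrow> real ^ 'n ^ 'm \<Rightarrow> real ^ 'n \<Rightarrow>
   real ^ 'n \<Rightarrow> real \<Rightarrow> real ^ 'm \<Rightarrow> real \<Rightarrow> ((real ^ 'np) \<times> real) set" where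
  "lp_feasible A b c B f yhat \<eta>hat g g\<^sub>0 =
     {(x, z). A *v x \<ge> b - B *v yhat - z *\<^sub>R g \<and>
              c \<bullet> x \<le> \<eta>hat - f \<bullet> yhat + z * g\<^sub>0 \<and>
              x \<ge> 0}"

end

theory Submission
  imports Defs
begin

text \<open>
  Let \<open>g\<close> be the gradient of \<open>h\<close> at the optimal solution \<open>p\<close>, and \<open>d\<close> the optimal value. Homogeneity gives
  Euler's identity \<open>p \<bullet> g = h p\<close>, and \<open>h p = 1\<close> unless \<open>d = 0\<close>. Pairing the constraints of the
  linear program with the dual solution \<open>p\<close> therefore shows \<open>z \<ge> d\<close>. Conversely, by homogeneity
  the objective is at most \<open>d * h\<close> on the part of the cone where \<open>h > 0\<close>, with equality at \<open>p\<close>.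
  Differentiating at \<open>p\<close> in a direction \<open>q\<close> of the cone shows that the objective at \<open>q\<close> is at most
  \<open>d * (q \<bullet> g)\<close>, which by Farkas' lemma says that \<open>z = d\<close> is feasible.
\<close>

text \<open>A finitely generated cone is closed, so a hyperplane strictly separates \<open>w\<close>
  from it. As the cone contains 0 and is closed under scaling, the separating functional cannot be
  negative on a generator; \<open>p\<close> is its negation.\<close>

lemma convex_cone_hull_farkas:
  fixes S :: "'a::euclidean_space set"
  assumes "finite S" "w \<notin> convex_cone hull S"
  obtains p where "\<And>s. s \<in> S \<Longrightarrow> p \<bullet> s \<le> 0" "0 < p \<bullet> w"
proof -
  have "closed (convex_cone hull S)"
    by (rule closed_convex_cone_hull) fact
  from separating_hyperplane_closed_point[OF convex_convex_cone_hull this assms(2)]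
  obtain a \<beta> where a: "a \<bullet> w < \<beta>" "\<And>x. x \<in> convex_cone hull S \<Longrightarrow> \<beta> < a \<bullet> x"
    by blast
  have "\<beta> < 0"
    using a(2)[OF convex_cone_hull_contains_0] by simp
  have "0 \<le> a \<bullet> s" if "s \<in> S" for s
  proof (rule ccontr)
    assume neg: "\<not> 0 \<le> a \<bullet> s"
    \<comment> \<open>Both \<open>\<beta>\<close> and \<open>a \<bullet> s\<close> are negative, so
      this is a positive multiple of \<open>s\<close>, chosen to lie on the hyperplane where
      \<open>a\<close> takes the value \<open>\<beta>\<close>.\<close>
    have "(\<beta> / (a \<bullet> s)) *\<^sub>R s \<in> convex_cone hull S"
      using that neg \<open>\<beta> < 0\<close> by (intro convex_cone_hull_mul hull_inc) (auto simp: divide_nonpos_neg)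
    from a(2)[OF this] neg show False by simp
  qed
  with a(1) \<open>\<beta> < 0\<close> show thesis
    by (intro that[of "- a"]) auto
qed

text \<open>These are the right-hand sides for which the primal system is solvable; solutions add
  and scale along with them.\<close>

lemma convex_cone_lp_rhs:
  fixes A :: "real ^ 'n ^ 'm"
  shows "convex_cone {(y, y\<^sub>0). \<exists>x\<ge>0. y \<le> A *v x \<and> c \<bullet> x \<le> - y\<^sub>0}" (is "convex_cone ?D")
  unfolding convex_cone_iff
proof (intro conjI ballI allI impI)
  show "0 \<in> ?D" by (auto simp: zero_prod_def intro!: exI[of _ 0])
next
  fix u v assume "u \<in> ?D" "v \<in> ?D"
  then obtain x x' where "0 \<le> x" "0 \<le> x'" "fst u \<le> A *v x" "fst v \<le> A *v x'"
    "c \<bullet> x \<le> - snd u" "c \<bullet> x' \<le> - snd v" by auto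
  then show "u + v \<in> ?D"
    by (auto simp: case_prod_beta matrix_vector_right_distrib inner_add_right
        intro!: exI[of _ "x + x'"] add_mono)
next
  fix u :: "(real ^ 'm) \<times> real" and t :: real
  assume "u \<in> ?D" "0 \<le> t"
  moreover from this obtain x where "0 \<le> x" "fst u \<le> A *v x" "c \<bullet> x \<le> - snd u" by auto
  ultimately have "0 \<le> t *\<^sub>R x" "t *\<^sub>R fst u \<le> A *v (t *\<^sub>R x)" "c \<bullet> (t *\<^sub>R x) \<le> - (t * snd u)"
    using mult_left_mono[of "c \<bullet> x" "- snd u" t]
    by (auto simp: matrix_vector_mult_scaleR scaleR_left_mono less_eq_vec_def mult_left_mono)
  then show "t *\<^sub>R u \<in> ?D"
    by (auto simp: case_prod_beta)
qed

text \<open>If the system has no solution, \<open>(w, w\<^sub>0)\<close> lies outside a finitely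
  generated cone of solvable right-hand sides. The separating vector is nonpositive on the
  generators, and these inequalities are exactly the constraints of
  \<open>dual_cone\<close>.\<close>

lemma dual_cone_farkas:
  fixes A :: "real ^ 'n ^ 'm"
  assumes "\<And>p. p \<in> dual_cone A c \<Longrightarrow> p \<bullet> (w, w\<^sub>0) \<le> 0"
  shows "\<exists>x\<ge>0. w \<le> A *v x \<and> c \<bullet> x \<le> - w\<^sub>0"
proof (rule ccontr)
  assume none: "\<not> ?thesis"
  define D where "D = {(y, y\<^sub>0). \<exists>x\<ge>0. y \<le> A *v x \<and> c \<bullet> x \<le> - y\<^sub>0}"
  \<comment> \<open>The columns of \<open>A\<close> with their negated costs come from the unit
    vectors \<open>x\<close>; the remaining generators are the slacks of the rows and of the cost
    inequality.\<close>
  define S where "S = range (\<lambda>j. (column j A, - c $ j)) \<union> range (\<lambda>i. (- axis i 1, 0)) \<union> {(0, - 1)}"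
  have "0 \<le> (axis j 1 :: real ^ 'n)" for j
    by (simp add: less_eq_vec_def axis_def)
  then have "(column j A, - c $ j) \<in> D" for j
    by (auto simp: D_def matrix_vector_mult_basis inner_axis intro!: exI[of _ "axis j 1"])
  moreover have "(- axis i 1, 0) \<in> D" "(0, - 1) \<in> D" for i
    by (auto simp: D_def less_eq_vec_def axis_def intro!: exI[of _ 0])
  ultimately have "convex_cone hull S \<subseteq> D"
    unfolding S_def D_def by (intro hull_minimal convex_cone_lp_rhs) blast
  with none have "(w, w\<^sub>0) \<notin> convex_cone hull S"
    by (auto simp: D_def)
  moreover have "finite S"
    by (simp add: S_def)
  ultimately obtain p where p: "\<And>s. s \<in> S \<Longrightarrow> p \<bullet> s \<le> 0" "0 < p \<bullet> (w, w\<^sub>0)"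
    using convex_cone_hull_farkas by blast
  obtain \<pi> \<pi>\<^sub>0 where [simp]: "p = (\<pi>, \<pi>\<^sub>0)" by (cases p)
  have "(\<pi> v* A) $ j \<le> \<pi>\<^sub>0 * c $ j" for j
    using p(1)[of "(column j A, - c $ j)"]
    by (auto simp: S_def inner_vec_def vector_matrix_mult_def column_def mult.commute)
  moreover have "0 \<le> \<pi> $ i" for i
    using p(1)[of "(- axis i 1, 0)"] by (auto simp: S_def inner_axis)
  moreover have "0 \<le> \<pi>\<^sub>0"
    using p(1)[of "(0, - 1)"] by (auto simp: S_def)
  ultimately have "p \<in> dual_cone A c"
    by (auto simp: dual_cone_def less_eq_vec_def)
  with assms p(2) show False by fastforce
qed

lemma dual_cone_add:
  "p \<in> dual_cone A c \<Longrightarrow> q \<in> dual_cone A c \<Longrightarrow> p + q \<in> dual_cone A c"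
  by (auto simp: dual_cone_def vector_matrix_left_distrib scaleR_left_distrib intro!: add_mono)

lemma dual_cone_scaleR:
  "0 \<le> t \<Longrightarrow> p \<in> dual_cone A c \<Longrightarrow> t *\<^sub>R p \<in> dual_cone A c"
  by (auto simp: dual_cone_def less_eq_vec_def scaleR_vector_matrix_assoc mult_left_mono mult.assoc)

lemma inner_mono_nonneg_vec:
  fixes u v w :: "real ^ 'n"
  shows "0 \<le> u \<Longrightarrow> v \<le> w \<Longrightarrow> u \<bullet> v \<le> u \<bullet> w"
  by (auto simp: inner_vec_def less_eq_vec_def intro!: sum_mono mult_left_mono)

text \<open>Weight the rows by \<open>\<pi>\<close> and the cost inequality by
  \<open>\<pi>\<^sub>0\<close>; the two bounds are linked by dual feasibility paired with
  \<open>x \<ge> 0\<close>.\<close>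

lemma lp_weak_duality:
  fixes A :: "real ^ 'np ^ 'm"
  assumes p: "p \<in> dual_cone A c" and xz: "(x, z) \<in> lp_feasible A b c B f yhat \<eta>hat g g\<^sub>0"
  shows "sep_objective b B f yhat \<eta>hat p \<le> z * (p \<bullet> (g, g\<^sub>0))"
proof -
  obtain \<pi> \<pi>\<^sub>0 where [simp]: "p = (\<pi>, \<pi>\<^sub>0)" by (cases p)
  have \<pi>: "\<pi> v* A \<le> \<pi>\<^sub>0 *\<^sub>R c" "0 \<le> \<pi>" "0 \<le> \<pi>\<^sub>0"
    using p by (auto simp: dual_cone_def)
  have x: "b - B *v yhat - z *\<^sub>R g \<le> A *v x" "c \<bullet> x \<le> \<eta>hat - f \<bullet> yhat + z * g\<^sub>0" "0 \<le> x"
    using xz by (auto simp: lp_feasible_def)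
  have "\<pi> \<bullet> (b - B *v yhat - z *\<^sub>R g) \<le> \<pi> \<bullet> (A *v x)"
    using \<pi>(2) x(1) by (rule inner_mono_nonneg_vec)
  also have "\<dots> = x \<bullet> (\<pi> v* A)"
    by (simp only: dot_lmul_matrix[symmetric] inner_commute)
  also have "\<dots> \<le> x \<bullet> (\<pi>\<^sub>0 *\<^sub>R c)"
    using x(3) \<pi>(1) by (rule inner_mono_nonneg_vec)
  also have "\<dots> = \<pi>\<^sub>0 * (c \<bullet> x)"
    by (simp add: inner_commute)
  also have "\<dots> \<le> \<pi>\<^sub>0 * (\<eta>hat - f \<bullet> yhat + z * g\<^sub>0)"
    using x(2) \<pi>(3) by (rule mult_left_mono)
  finally show ?thesis
    by (simp add: sep_objective_def algebra_simps)
qed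

lemma GDERIV_along_line:
  assumes "GDERIV h p :> g"
  shows "((\<lambda>t. h (p + t *\<^sub>R q)) has_real_derivative q \<bullet> g) (at 0)"
proof -
  have "(h has_derivative (\<lambda>v. v \<bullet> g)) (at (p + 0 *\<^sub>R q))"
    using assms by (simp add: gderiv_def)
  moreover have "((\<lambda>t. p + t *\<^sub>R q) has_derivative (\<lambda>t. t *\<^sub>R q)) (at 0)"
    by (auto intro!: derivative_eq_intros)
  ultimately have "((\<lambda>t. h (p + t *\<^sub>R q)) has_derivative (\<lambda>t. (t *\<^sub>R q) \<bullet> g)) (at 0)"
    by (rule has_derivative_compose[rotated])
  then show ?thesis
    by (simp add: has_derivative_imp_has_field_derivative)
qed

text \<open>Along the ray through \<open>p\<close> homogeneity makes \<open>h\<close> linear, so its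
  slope there can be read off in two ways.\<close>

lemma pos_homogeneous_euler:
  assumes "pos_homogeneous h" "GDERIV h p :> g"
  shows "p \<bullet> g = h p"
proof (rule DERIV_unique)
  show "((\<lambda>t. h (p + t *\<^sub>R p)) has_real_derivative p \<bullet> g) (at 0)"
    using assms(2) by (rule GDERIV_along_line)
  have "((\<lambda>t. (1 + t) * h p) has_real_derivative h p) (at 0)"
    by (auto intro!: derivative_eq_intros)
  then show "((\<lambda>t. h (p + t *\<^sub>R p)) has_real_derivative h p) (at 0)"
  \<comment> \<open>Homogeneity covers only nonnegative factors \<open>1 + t\<close>, hence the
    neighbourhood \<open>t > -1\<close> of 0.\<close>
  proof (rule has_field_derivative_transform_within_open[where S = "{-1<..}"])
    fix t :: real assume "t \<in> {-1<..}"
    with assms(1) have "h ((1 + t) *\<^sub>R p) = (1 + t) * h p"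
      by (simp add: pos_homogeneous_def)
    then show "(1 + t) * h p = h (p + t *\<^sub>R p)"
      by (simp add: scaleR_left_distrib)
  qed auto
qed

lemma sep_objective_eq_inner:
  "sep_objective b B f yhat \<eta>hat p = p \<bullet> (b - B *v yhat, f \<bullet> yhat - \<eta>hat)"
  by (simp add: sep_objective_def case_prod_beta inner_prod_def)

theorem theorem2:
  fixes A :: "real ^ 'np ^ 'm" and B :: "real ^ 'n ^ 'm"
    and b :: "real ^ 'm" and c :: "real ^ 'np" and f :: "real ^ 'n"
    and yhat :: "real ^ 'n" and \<eta>hat :: real
    and h :: "(real ^ 'm) \<times> real \<Rightarrow> real"
    and \<pi>s :: "real ^ 'm" and \<pi>0s :: real
  assumes convex: "convex_on UNIV h"
    and differentiable: "h differentiable_on (- {0})"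
    and homogeneous: "pos_homogeneous h"
    and optimal: "is_arg_max (sep_objective b B f yhat \<eta>hat) (\<lambda>p. p \<in> sep_feasible A c h) (\<pi>s, \<pi>0s)"
    and nondegenerate: "sep_value A b c B f h yhat \<eta>hat = 0 \<Longrightarrow> 0 < h (\<pi>s, \<pi>0s)"
  shows "\<exists>x z. is_arg_min snd
             (\<lambda>s. s \<in> lp_feasible A b c B f yhat \<eta>hat (grad_pi h (\<pi>s, \<pi>0s)) (grad_pi0 h (\<pi>s, \<pi>0s)))
             (x, z) \<and>
           sep_value A b c B f h yhat \<eta>hat = z"
proof -
  define p where "p = (\<pi>s, \<pi>0s)"
  define W where "W = (b - B *v yhat, f \<bullet> yhat - \<eta>hat)"
  define d where "d = sep_value A b c B f h yhat \<eta>hat"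
  define g where "g = gradient h p"
  have hom: "h (t *\<^sub>R q) = t * h q" if "0 \<le> t" for t q
    using homogeneous that unfolding pos_homogeneous_def by blast
  have h0: "h 0 = 0"
    using hom[of 0 0] by simp
  have p: "p \<in> dual_cone A c" "h p \<le> 1"
    using optimal by (auto simp: is_arg_max_def sep_feasible_def p_def)
  have max: "q \<bullet> W \<le> p \<bullet> W" if "q \<in> dual_cone A c" "h q \<le> 1" for q
    using optimal that unfolding is_arg_max_linorder sep_feasible_def sep_objective_eq_inner p_def W_def
    by blast
  have d: "d = p \<bullet> W"
    unfolding d_def sep_value_def
    by (rule cSup_eq_maximum) (use p max in \<open>auto simp: sep_feasible_def sep_objective_eq_inner W_def\<close>)
  have "0 \<le> d"
    using max[of 0] dual_cone_scaleR[of 0 p A c] p h0 d by simp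
  have scaled: "q \<bullet> W \<le> d * h q" if q: "q \<in> dual_cone A c" "0 < h q" for q
  proof -
    \<comment> \<open>Rescaling \<open>q\<close> to \<open>h\<close>-value 1 makes it
      feasible.\<close>
    have "((1 / h q) *\<^sub>R q) \<bullet> W \<le> d"
      unfolding d using q hom[of "1 / h q" q] by (intro max dual_cone_scaleR) auto
    with q show ?thesis by (simp add: field_simps)
  qed
  have hp: "0 < h p"
  proof (cases "d = 0")
    case True
    \<comment> \<open>At value zero the origin is optimal as well, so optimality alone does not give
      positivity.\<close>
    then show ?thesis using nondegenerate by (simp add: d_def p_def)
  next
    case False
    show ?thesis
    proof (rule ccontr)
      assume "\<not> 0 < h p"
      \<comment> \<open>If \<open>h p \<le> 0\<close>, then doubling \<open>p\<close> keeps it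
        feasible and doubles a positive objective.\<close>
      with hom[of 2 p] have "(2 *\<^sub>R p) \<bullet> W \<le> p \<bullet> W"
        using p by (intro max dual_cone_scaleR) auto
      with d \<open>0 \<le> d\<close> False show False by simp
    qed
  qed
  have dhp: "d * h p = d"
    using scaled[OF p(1) hp] p(2) \<open>0 \<le> d\<close> d mult_left_mono[of "h p" 1 d] by simp
  have "p \<noteq> 0"
    using hp h0 by auto
  with differentiable have "h differentiable (at p)"
    by (simp add: differentiable_on_eq_differentiable_at open_Compl)
  then have g: "GDERIV h p :> g"
    unfolding g_def by (rule gderiv_gradient)
  have euler: "p \<bullet> g = h p"
    using homogeneous g by (rule pos_homogeneous_euler)
  have "q \<bullet> W \<le> d * (q \<bullet> g)" if q: "q \<in> dual_cone A c" for q
  proof (rule ccontr)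
    assume neg: "\<not> ?thesis"
    \<comment> \<open>The gap in the bound \<open>scaled\<close> along the ray from \<open>p\<close>
      towards \<open>q\<close>. It vanishes at 0, so a negative slope there would make it negative
      for small \<open>t > 0\<close>.\<close>
    define \<phi> where "\<phi> t = d * h (p + t *\<^sub>R q) - (p + t *\<^sub>R q) \<bullet> W" for t
    note line = GDERIV_along_line[OF g, of q]
    have "(\<phi> has_real_derivative d * (q \<bullet> g) - q \<bullet> W) (at 0)"
      unfolding \<phi>_def inner_add_left inner_scaleR_left
      by (rule derivative_eq_intros line refl | simp)+
    from DERIV_neg_dec_right[OF this] neg obtain \<delta>
      where \<delta>: "\<delta> > 0" "\<And>t. 0 < t \<Longrightarrow> t < \<delta> \<Longrightarrow> \<phi> t < \<phi> 0" by auto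
    \<comment> \<open>Continuity keeps \<open>h\<close> positive near \<open>p\<close>, as
      \<open>scaled\<close> requires.\<close>
    have "((\<lambda>t. h (p + t *\<^sub>R q)) \<longlongrightarrow> h p) (at 0)"
      using DERIV_isCont[OF line] by (simp add: isCont_def)
    with hp have "\<forall>\<^sub>F t in at 0. 0 < h (p + t *\<^sub>R q)"
      by (simp add: order_tendsto_iff)
    then have "\<forall>\<^sub>F t in at_right 0. 0 < h (p + t *\<^sub>R q)"
      by (simp add: eventually_at_split)
    moreover have "\<forall>\<^sub>F t in at_right 0. t \<in> {0<..<\<delta>}"
      using \<delta>(1) by (rule eventually_at_right_real)
    ultimately have "\<forall>\<^sub>F t in at_right (0::real). 0 < h (p + t *\<^sub>R q) \<and> t \<in> {0<..<\<delta>}"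
      by (rule eventually_conj)
    then obtain t where t: "0 < h (p + t *\<^sub>R q)" "0 < t" "t < \<delta>"
      using eventually_happens'[OF trivial_limit_at_right_real] by fastforce
    have "(p + t *\<^sub>R q) \<bullet> W \<le> d * h (p + t *\<^sub>R q)"
      using p q t by (intro scaled dual_cone_add dual_cone_scaleR) auto
    then have "0 \<le> \<phi> t"
      by (simp add: \<phi>_def)
    moreover have "\<phi> 0 = 0"
      using dhp d by (auto simp: \<phi>_def)
    ultimately show False
      using \<delta>(2)[of t] t by simp
  qed
  then have "\<exists>x\<ge>0. b - B *v yhat - d *\<^sub>R fst g \<le> A *v x \<and>
      c \<bullet> x \<le> - (f \<bullet> yhat - \<eta>hat - d * snd g)"
    by (intro dual_cone_farkas) (force simp: W_def inner_prod_def algebra_simps)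
  then obtain x where x: "(x, d) \<in> lp_feasible A b c B f yhat \<eta>hat (fst g) (snd g)"
    by (auto simp: lp_feasible_def algebra_simps)
  have "d \<le> z" if "(x', z) \<in> lp_feasible A b c B f yhat \<eta>hat (fst g) (snd g)" for x' z
  proof -
    \<comment> \<open>Weak duality at \<open>p\<close> with Euler's identity gives
      \<open>d \<le> z * h p\<close>; writing \<open>d\<close> as \<open>d * h p\<close> lets the
      positive factor cancel.\<close>
    have "d * h p \<le> z * h p"
      unfolding dhp using lp_weak_duality[OF p(1) that] euler d
      by (simp add: sep_objective_eq_inner W_def)
    with hp show ?thesis by simp
  qed
  with x have "is_arg_min snd (\<lambda>s. s \<in> lp_feasible A b c B f yhat \<eta>hat (fst g) (snd g)) (x, d)"
    by (auto simp: is_arg_min_linorder)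
  then show ?thesis
    by (auto simp: d_def g_def p_def grad_pi_def grad_pi0_def)
qed

end
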